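(* Every finite nilpotent group of order at least $3$ is a DEG-group.
   Context: A subset $D$ of a group $G$ is a determining set of $G$ if the only automorphism of $G$ that fixes every element of $D$ is the identity automorphism. The determining number $\alpha(G)$ is the cardinality of a smallest determining set of $G$ ($\alpha(G)=0$ if $G$ has only the identity automorphism). The generating number $\gamma(G)$ is the cardinality of a smallest generating set of $G$. A group $G$ is a DEG-group if $\alpha(G)=\gamma(G)$. *)

theory Defs
  imports "HOL-Algebra.Algebra" "HOL-Library.Extended_Nat"
begin

definition determining_set :: "('a, 'b) monoid_scheme \<Rightarrow> 'a set \<Rightarrow> bool" where
  "determining_set G D \<longleftrightarrow> D \<subseteq> carrier G \<and>
     (\<forall>\<phi>\<in>auto G. (\<forall>x\<in>D. \<phi> x = x) \<longrightarrow> (\<forall>x\<in>carrier G. \<phi> x = x))"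

definition generating_set :: "('a, 'b) monoid_scheme \<Rightarrow> 'a set \<Rightarrow> bool" where
  "generating_set G S \<longleftrightarrow> S \<subseteq> carrier G \<and> generate G S = carrier G"

text \<open>Both numbers are extended naturals, with value \<open>\<infinity>\<close> when no finite determining
  (generating) set exists. Restricting to finite sets is needed because \<open>card\<close> is 0 on
  infinite sets. Different infinite cardinalities are not distinguished.\<close>

definition determining_number :: "('a, 'b) monoid_scheme \<Rightarrow> enat" where
  "determining_number G = (INF D\<in>{D. determining_set G D \<and> finite D}. enat (card D))"

definition generating_number :: "('a, 'b) monoid_scheme \<Rightarrow> enat" where
  "generating_number G = (INF S\<in>{S. generating_set G S \<and> finite S}. enat (card S))"

definition DEG_group :: "('a, 'b) monoid_scheme \<Rightarrow> bool" where
  "DEG_group G \<longleftrightarrow> group G \<and> determining_number G = generating_number G"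

definition commutator_subgroup :: "('a, 'b) monoid_scheme \<Rightarrow> 'a set \<Rightarrow> 'a set \<Rightarrow> 'a set" where
  "commutator_subgroup G H K =
     generate G (\<Union>h\<in>H. \<Union>k\<in>K. {h \<otimes>\<^bsub>G\<^esub> k \<otimes>\<^bsub>G\<^esub> inv\<^bsub>G\<^esub> h \<otimes>\<^bsub>G\<^esub> inv\<^bsub>G\<^esub> k})"

lemma commutator_subgroup_self: "commutator_subgroup G H H = derived G H"
  by (simp add: commutator_subgroup_def derived_def)

primrec lower_central_series :: "('a, 'b) monoid_scheme \<Rightarrow> nat \<Rightarrow> 'a set" where
  "lower_central_series G 0 = carrier G"
| "lower_central_series G (Suc n) =
     commutator_subgroup G (lower_central_series G n) (carrier G)"

definition nilpotent_group :: "('a, 'b) monoid_scheme \<Rightarrow> bool" where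
  "nilpotent_group G \<longleftrightarrow> group G \<and> (\<exists>n. lower_central_series G n = {\<one>\<^bsub>G\<^esub>})"

end

theory Submission
  imports Defs
begin

text \<open>A generating set is determining, because an automorphism is known once it is known on
  generators. The content is the converse inequality: from a determining set \<open>D\<close> one has to
  produce a generating set with at most as many elements.

  Suppose that \<open>D\<close> does not generate \<open>G\<close>, and put it into a maximal subgroup \<open>M\<close>. Since \<open>G\<close> is
  nilpotent, \<open>M\<close> is normal of prime index \<open>p\<close> (\<open>nilpotent_maximal_subgroup_normal\<close>,
  \<open>maximal_normal_index_prime\<close>), and there is a central element \<open>z\<close> of order \<open>p\<close>
  (\<open>central_element_of_prime_order\<close>). Multiplying the coset \<open>M g\<^sup>k\<close> by \<open>w\<^sup>k\<close>, where \<open>w\<close> is a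
  suitable power of \<open>z\<close>, is an endomorphism that fixes \<open>M\<close> pointwise and moves \<open>g\<close>. It is
  injective for \<open>w = z\<close> when \<open>z \<in> M\<close>. When \<open>z \<notin> M\<close>, one takes \<open>g = z\<close> and \<open>w = z\<^sup>-\<^sup>2\<close>; this
  inverts the complement \<open>\<langle>z\<rangle>\<close> of \<open>M\<close> and is not the identity provided that \<open>p\<close> is odd. So a
  determining set that does not generate can only lie in maximal subgroups of index 2 that
  contain no central involution (\<open>automorphism_fixing_maximal_subgroup\<close>).

  In this remaining situation \<open>M\<close> has odd order and \<open>z\<close> is a central involution outside \<open>M\<close>.
  Any maximal subgroup above \<open>D \<union> {z}\<close> would contain \<open>z\<close>, and so would not be of the exceptional
  kind; hence \<open>D \<union> {z}\<close> generates \<open>G\<close>. As \<open>G\<close> has more than two elements, \<open>D\<close> contains some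
  \<open>d\<close>. Replacing \<open>d\<close> by \<open>d z\<close> costs nothing and yields a generating set: \<open>d\<close> has odd order, so
  both \<open>z\<close> and \<open>d\<close> are powers of \<open>d z\<close> (\<open>determining_set_imp_generating_set\<close>).\<close>

context group
begin

section \<open>The lower central series\<close>

lemma commutator_in_lower_central_series_Suc:
  assumes "h \<in> lower_central_series G n" "k \<in> carrier G"
  shows "h \<otimes> k \<otimes> inv h \<otimes> inv k \<in> lower_central_series G (Suc n)"
  using assms by (auto simp: commutator_subgroup_def intro!: generate.incl)

text \<open>Normality of a term gives the inclusion of the next term, because a commutator \<open>[h, k]\<close>
  is \<open>h\<close> times a conjugate of \<open>h\<^sup>-\<^sup>1\<close>. That inclusion makes the next term normal in turn: a conjugate
  of \<open>y\<close> differs from \<open>y\<close> by a commutator of \<open>y\<close>.\<close>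
lemma lower_central_series_normal_decreasing:
  "lower_central_series G n \<lhd> G \<and> lower_central_series G (Suc n) \<subseteq> lower_central_series G n"
proof -
  have decreasing: "lower_central_series G (Suc n) \<subseteq> lower_central_series G n"
    if "lower_central_series G n \<lhd> G" for n
  proof -
    interpret L: normal "lower_central_series G n" G by fact
    have "h \<otimes> k \<otimes> inv h \<otimes> inv k \<in> lower_central_series G n"
      if "h \<in> lower_central_series G n" "k \<in> carrier G" for h k
    proof -
      have "h \<otimes> k \<otimes> inv h \<otimes> inv k = h \<otimes> (k \<otimes> inv h \<otimes> inv k)"
        using that L.subset by (simp add: m_assoc subset_iff)
      then show ?thesis using that L.inv_op_closed2 by simp
    qed
    then show ?thesis
      unfolding lower_central_series.simps commutator_subgroup_def
      by (intro generate_subgroup_incl[OF _ L.subgroup_axioms] UN_least) auto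
  qed
  have "lower_central_series G n \<lhd> G"
  proof (induction n)
    case 0
    show ?case by (simp add: normal_self)
  next
    case (Suc n)
    interpret L: normal "lower_central_series G n" G by fact
    have sub: "subgroup (lower_central_series G (Suc n)) G"
      unfolding lower_central_series.simps commutator_subgroup_def
      using L.subset by (intro generate_is_subgroup UN_least) auto
    show ?case
    proof (rule normal_invI[OF sub])
      fix g y assume g: "g \<in> carrier G" and y: "y \<in> lower_central_series G (Suc n)"
      let ?t = "y \<otimes> g \<otimes> inv y \<otimes> inv g"
      have yc: "y \<in> carrier G" by (rule subgroup.mem_carrier[OF sub y])
      have "?t \<in> lower_central_series G (Suc n)"
        using commutator_in_lower_central_series_Suc[OF _ g] decreasing[OF Suc] y by blast
      moreover have "g \<otimes> y \<otimes> inv g = inv ?t \<otimes> y"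
        using g yc by (simp add: inv_mult_group m_assoc)
      ultimately show "g \<otimes> y \<otimes> inv g \<in> lower_central_series G (Suc n)"
        using y sub by (simp add: subgroup.m_closed subgroup.m_inv_closed del: lower_central_series.simps)
    qed
  qed
  with decreasing show ?thesis by blast
qed

section \<open>Central elements of prime order\<close>

text \<open>Read modulo \<open>L\<close>: if \<open>x\<close> commutes with the powers of the commutator \<open>c = [x, g]\<close>, then
  \<open>[x\<^sup>k, g] = c\<^sup>k\<close>. For an \<open>x\<close> with \<open>x\<^sup>k = 1\<close> this puts \<open>c\<^sup>k\<close> into \<open>L\<close>.\<close>
lemma power_conjugation_mod_normal:
  fixes k :: nat
  assumes "L \<lhd> G" and x: "x \<in> carrier G" and g: "g \<in> carrier G" and c: "c \<in> carrier G"
    and xg: "x \<otimes> g = c \<otimes> g \<otimes> x"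
    and xc: "\<And>k::nat. \<exists>l\<in>L. x \<otimes> c [^] k = l \<otimes> c [^] k \<otimes> x"
  shows "\<exists>l\<in>L. x [^] k \<otimes> g = l \<otimes> c [^] k \<otimes> g \<otimes> x [^] k"
proof (induction k)
  interpret L: normal L G by fact
  case 0
  show ?case using g L.one_closed by (intro bexI[of _ \<one>]) auto
next
  interpret L: normal L G by fact
  case (Suc k)
  then obtain l where l: "l \<in> L" "x [^] k \<otimes> g = l \<otimes> c [^] k \<otimes> g \<otimes> x [^] k" by blast
  obtain l' where l': "l' \<in> L" "x \<otimes> c [^] k = l' \<otimes> c [^] k \<otimes> x" using xc by blast
  have lc: "l \<in> carrier G" "l' \<in> carrier G" using l l' by auto
  have "x [^] Suc k \<otimes> g = x \<otimes> (x [^] k \<otimes> g)"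
    using x g by (simp only: nat_pow_Suc2 m_assoc nat_pow_closed)
  also have "\<dots> = (x \<otimes> l \<otimes> inv x) \<otimes> (x \<otimes> c [^] k) \<otimes> g \<otimes> x [^] k"
    using l(2) lc x g c by (simp add: m_assoc) (simp add: inv_solve_left' flip: m_assoc)
  also have "\<dots> = (x \<otimes> l \<otimes> inv x \<otimes> l') \<otimes> c [^] k \<otimes> (x \<otimes> g) \<otimes> x [^] k"
    using l'(2) lc x g c by (simp add: m_assoc)
  also have "\<dots> = (x \<otimes> l \<otimes> inv x \<otimes> l') \<otimes> c [^] Suc k \<otimes> g \<otimes> x [^] Suc k"
    using lc x g c unfolding xg nat_pow_Suc2[OF x] by (simp add: m_assoc)
  finally show ?case using l l' x L.inv_op_closed2 by blast
qed

text \<open>Cauchy's theorem, as the special case of Sylow's theorem for the first power of \<open>p\<close>.\<close>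
lemma element_of_prime_order_in_subgroup:
  fixes p :: nat
  assumes "subgroup N G" "finite N" "Factorial_Ring.prime p" "p dvd card N"
  shows "\<exists>x\<in>N. x \<noteq> \<one> \<and> x [^] p = \<one>"
proof -
  interpret N: group "G\<lparr>carrier := N\<rparr>" using assms(1) by (rule subgroup_imp_group)
  obtain m where "order (G\<lparr>carrier := N\<rparr>) = p ^ 1 * m"
    using assms(4) by (auto simp: order_def)
  then obtain H where H: "subgroup H (G\<lparr>carrier := N\<rparr>)" "card H = p ^ 1"
    using sylow_thm[OF assms(3) N.is_group, of 1 m] assms(2) by auto
  have HG: "subgroup H G" using H(1) assms(1) incl_subgroup by blast
  then interpret H: group "G\<lparr>carrier := H\<rparr>" by (rule subgroup_imp_group)
  have "1 < card H" using H(2) prime_gt_1_nat[OF assms(3)] by simp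
  then obtain x where x: "x \<in> H" "x \<noteq> \<one>"
    by (metis One_nat_def card_mono finite.emptyI finite_insert insert_iff not_less subsetI card_1_singleton_iff)
  have "x [^] p = \<one>"
    using H.pow_order_eq_1[of x] x(1) H(2) by (simp add: order_def flip: nat_pow_consistent)
  moreover have "x \<in> N" using H(1) x(1) subgroup.subset by fastforce
  ultimately show ?thesis using x by blast
qed

text \<open>Without elements of order \<open>p\<close> in \<open>K\<close>, the order of \<open>c\<close> is prime to \<open>p\<close>, so \<open>c\<close> is itself a
  power of \<open>c\<^sup>p\<close>.\<close>
lemma p_torsion_free_mem_if_pow_mem:
  fixes p :: nat
  assumes fin: "finite (carrier G)" and K: "subgroup K G" and L: "subgroup L G" and c: "c \<in> K"
    and p: "Factorial_Ring.prime p" and pow: "c [^] p \<in> L"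
    and free: "\<And>y. y \<in> K \<Longrightarrow> y [^] p = \<one> \<Longrightarrow> y = \<one>"
  shows "c \<in> L"
proof -
  have cc: "c \<in> carrier G" by (rule subgroup.mem_carrier[OF K c])
  have "\<not> p dvd ord c"
  proof
    assume "p dvd ord c"
    then obtain m where m: "ord c = m * p" by (metis dvdE mult.commute)
    have "(c [^] m) [^] p = \<one>" using cc m by (simp add: nat_pow_pow pow_eq_id)
    moreover have "c [^] m \<in> K"
      using subgroup_int_pow_closed[OF K c, of "int m"] by (simp add: int_pow_int)
    ultimately have "c [^] m = \<one>" using free by blast
    then have "m * p dvd m" using cc m pow_eq_id by metis
    moreover have "m > 0" using m ord_ge_1[OF fin cc] by (cases m) auto
    ultimately show False using prime_gt_1_nat[OF p] by (auto dest: dvd_imp_le)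
  qed
  then have "coprime p (ord c)" using p prime_imp_coprime by blast
  then have "coprime (int p) (int (ord c))" by simp
  then obtain u v where uv: "u * int p + v * int (ord c) = 1"
    by (metis bezout_int coprime_imp_gcd_eq_1)
  have "c = c [^] (int p * u + int (ord c) * v)" using uv cc by (simp add: mult.commute)
  also have "\<dots> = (c [^] p) [^] u \<otimes> (c [^] ord c) [^] v"
    using cc by (simp add: int_pow_mult int_pow_pow[symmetric] int_pow_int)
  also have "\<dots> = (c [^] p) [^] u" using cc by simp
  finally show ?thesis using subgroup_int_pow_closed[OF L pow, of u] by simp
qed


text \<open>Take an element \<open>x\<close> of order \<open>p\<close> in \<open>N\<close> as deep in the lower central series as possible. Its
  commutators lie in \<open>N\<close> and one term deeper, where there is no \<open>p\<close>-torsion left. If all of them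
  lie in a term of the series, then modulo the next term their \<open>p\<close>-th powers are \<open>[x\<^sup>p, g] = 1\<close>, and
  the absence of \<open>p\<close>-torsion puts them into that next term too. So they sink through the
  whole series and are trivial.\<close>
lemma central_element_of_prime_order:
  fixes p :: nat
  assumes fin: "finite (carrier G)" and nil: "lower_central_series G n = {\<one>}"
    and "N \<lhd> G" and p: "Factorial_Ring.prime p" and dvd: "p dvd card N"
  shows "\<exists>z\<in>N. z \<noteq> \<one> \<and> z [^] p = \<one> \<and> (\<forall>g\<in>carrier G. z \<otimes> g = g \<otimes> z)"
proof -
  let ?L = "lower_central_series G"
  interpret N: normal N G by fact
  define P where "P i \<longleftrightarrow> (\<exists>x\<in>N \<inter> ?L i. x \<noteq> \<one> \<and> x [^] p = \<one>)" for i
  have "\<exists>x\<in>N. x \<noteq> \<one> \<and> x [^] p = \<one>"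
    using element_of_prime_order_in_subgroup[OF N.subgroup_axioms _ p dvd] fin N.subset finite_subset by blast
  then have "P 0" using N.subset unfolding P_def by auto
  moreover have "\<not> P n" using nil by (auto simp: P_def)
  ultimately obtain i where i: "P i" "\<not> P (Suc i)" using nat_induct[of P n] by blast
  then obtain x where x: "x \<in> N" "x \<in> ?L i" "x \<noteq> \<one>" "x [^] p = \<one>"
    unfolding P_def by blast
  have xc: "x \<in> carrier G" using x(1) by (rule N.mem_carrier)
  have comm: "x \<otimes> g \<otimes> inv x \<otimes> inv g \<in> ?L (Suc i + j)" if "g \<in> carrier G" for g j
    using that
  proof (induction j arbitrary: g)
    case 0
    then show ?case using commutator_in_lower_central_series_Suc[OF x(2)] by simp
  next
    case (Suc j)
    let ?c = "x \<otimes> g \<otimes> inv x \<otimes> inv g" and ?M = "?L (Suc (Suc i + j))"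
    note g = Suc.prems
    have M: "?M \<lhd> G" and M': "?L (Suc i + j) \<lhd> G" and M'': "?L (Suc i) \<lhd> G"
      using lower_central_series_normal_decreasing by blast+
    have c: "?c \<in> carrier G" using xc g by simp
    have cpow: "?c [^] k \<in> ?L (Suc i + j)" for k :: nat
      using subgroup_int_pow_closed[OF normal_imp_subgroup[OF M'] Suc.IH[OF g], of "int k"]
      by (simp add: int_pow_int)
    have "\<exists>l\<in>?M. x \<otimes> ?c [^] k = l \<otimes> ?c [^] k \<otimes> x" for k :: nat
    proof
      let ?d = "?c [^] k"
      have d: "?d \<in> carrier G" using c by simp
      show "x \<otimes> ?d = inv (?d \<otimes> x \<otimes> inv ?d \<otimes> inv x) \<otimes> ?d \<otimes> x"
        using xc d by (simp add: inv_mult_group m_assoc del: nat_pow_closed)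
      show "inv (?d \<otimes> x \<otimes> inv ?d \<otimes> inv x) \<in> ?M"
        using subgroup.m_inv_closed[OF normal_imp_subgroup[OF M]]
          commutator_in_lower_central_series_Suc[OF cpow xc] by blast
    qed
    moreover have "x \<otimes> g = ?c \<otimes> g \<otimes> x" using xc g by (simp add: m_assoc)
    ultimately obtain l where l: "l \<in> ?M" "x [^] p \<otimes> g = l \<otimes> ?c [^] p \<otimes> g \<otimes> x [^] p"
      using power_conjugation_mod_normal[OF M xc g c] by blast
    have lc: "l \<in> carrier G" by (rule subgroup.mem_carrier[OF normal_imp_subgroup[OF M] l(1)])
    have d: "?c [^] p \<in> carrier G" using c by simp
    \<comment> \<open>With \<open>x\<^sup>p = 1\<close>, cancelling \<open>g\<close> leaves \<open>c\<^sup>p\<close> as the inverse of an element of the next term.\<close>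
    have "\<one> = l \<otimes> ?c [^] p"
      using l(2) x(4) g lc d by (metis l_one m_closed one_closed r_cancel r_one)
    then have "?c [^] p = inv l" using lc d by (metis inv_equality inv_inv)
    then have pow: "?c [^] p \<in> ?M"
      using subgroup.m_inv_closed[OF normal_imp_subgroup[OF M] l(1)] by simp
    have "?c = x \<otimes> (g \<otimes> inv x \<otimes> inv g)" using xc g by (simp add: m_assoc)
    then have "?c \<in> N" using x(1) g N.inv_op_closed2 by simp
    then have K: "?c \<in> N \<inter> ?L (Suc i)"
      using commutator_in_lower_central_series_Suc[OF x(2) g] by blast
    have "y = \<one>" if "y \<in> N \<inter> ?L (Suc i)" "y [^] p = \<one>" for y
      using i(2) that unfolding P_def by blast
    then have "?c \<in> ?M"
      using p_torsion_free_mem_if_pow_mem[OF fin _ normal_imp_subgroup[OF M] K p pow]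
        subgroups_Inter_pair[OF N.subgroup_axioms normal_imp_subgroup[OF M'']] by blast
    then show ?case by (simp only: add_Suc_right)
  qed
  have "antimono ?L"
    using lower_central_series_normal_decreasing by (intro decseq_SucI) blast
  then have "?L (Suc i + n) \<subseteq> ?L n" by (rule antimonoD) simp
  then have "x \<otimes> g \<otimes> inv x \<otimes> inv g = \<one>" if "g \<in> carrier G" for g
    using comm[OF that, of n] nil by blast
  then have "x \<otimes> g = g \<otimes> x" if "g \<in> carrier G" for g
    using that xc by (metis inv_closed inv_equality inv_inv inv_solve_right m_closed l_one)
  then show ?thesis using x by blast
qed

section \<open>Maximal subgroups of nilpotent groups\<close>

definition maximal_subgroup :: "'a set \<Rightarrow> bool" where
  "maximal_subgroup M \<longleftrightarrow> subgroup M G \<and> M \<noteq> carrier G \<and>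
     (\<forall>K. subgroup K G \<longrightarrow> M \<subset> K \<longrightarrow> K = carrier G)"

lemma proper_subgroup_in_maximal:
  assumes fin: "finite (carrier G)" and "subgroup H G" "H \<noteq> carrier G"
  shows "\<exists>M. maximal_subgroup M \<and> H \<subseteq> M"
proof -
  let ?A = "{K. subgroup K G \<and> K \<noteq> carrier G}"
  have "?A \<subseteq> Pow (carrier G)" by (auto dest: subgroup.subset)
  then have "finite ?A" using fin by (auto intro: finite_subset)
  moreover have "H \<in> ?A" using assms by simp
  ultimately obtain M where M: "M \<in> ?A" "H \<subseteq> M" "\<forall>K\<in>?A. M \<subseteq> K \<longrightarrow> M = K"
    using finite_has_maximal2 by meson
  then have "maximal_subgroup M" unfolding maximal_subgroup_def by auto
  with M(2) show ?thesis by blast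
qed

text \<open>The last term of the series that is not contained in \<open>M\<close> normalizes \<open>M\<close>, because its
  commutators lie in the next term and hence in \<open>M\<close>. So the normalizer of \<open>M\<close> is strictly larger
  than \<open>M\<close>, and maximality makes it the whole group.\<close>
lemma nilpotent_maximal_subgroup_normal:
  assumes nil: "lower_central_series G n = {\<one>}" and "maximal_subgroup M"
  shows "M \<lhd> G"
proof -
  let ?L = "lower_central_series G"
  have M: "subgroup M G" "M \<noteq> carrier G" "\<And>K. subgroup K G \<Longrightarrow> M \<subset> K \<Longrightarrow> K = carrier G"
    using assms(2) by (auto simp: maximal_subgroup_def)
  have Mc: "M \<subseteq> carrier G" using M(1) by (rule subgroup.subset)
  have "\<not> ?L 0 \<subseteq> M" using M(2) Mc by auto
  moreover have "?L n \<subseteq> M" using nil M(1) subgroup.one_closed by auto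
  ultimately obtain i where i: "\<not> ?L i \<subseteq> M" "?L (Suc i) \<subseteq> M"
    using nat_induct[of "\<lambda>i. \<not> ?L i \<subseteq> M" n] by blast
  then obtain x where x: "x \<in> ?L i" "x \<notin> M" by blast
  have L: "subgroup (?L i) G" using lower_central_series_normal_decreasing normal_imp_subgroup by blast
  have conj: "y \<otimes> m \<otimes> inv y \<in> M" if "y \<in> ?L i" "m \<in> M" for y m
  proof -
    have yc: "y \<in> carrier G" "m \<in> carrier G" using subgroup.mem_carrier[OF L] that Mc by blast+
    have "y \<otimes> m \<otimes> inv y \<otimes> inv m \<in> M"
      using commutator_in_lower_central_series_Suc[OF that(1) yc(2)] i(2) by blast
    then have "y \<otimes> m \<otimes> inv y \<otimes> inv m \<otimes> m \<in> M" using subgroup.m_closed[OF M(1) _ that(2)] by blast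
    moreover have "y \<otimes> m \<otimes> inv y \<otimes> inv m \<otimes> m = y \<otimes> m \<otimes> inv y"
      using yc by (simp add: m_assoc)
    ultimately show ?thesis by simp
  qed
  have xc: "x \<in> carrier G" "inv x \<in> ?L i"
    using subgroup.mem_carrier[OF L x(1)] subgroup.m_inv_closed[OF L x(1)] by blast+
  have "x <# M #> (inv x) = M"
  proof
    show "x <# M #> (inv x) \<subseteq> M" using conj[OF x(1)] by (auto simp: l_coset_def r_coset_def)
    show "M \<subseteq> x <# M #> (inv x)"
    proof
      fix m assume m: "m \<in> M"
      have "inv x \<otimes> m \<otimes> x \<in> M" using conj[OF xc(2) m] xc by simp
      moreover have "m = x \<otimes> (inv x \<otimes> m \<otimes> x) \<otimes> inv x"
      proof -
        have mc: "m \<in> carrier G" using m Mc by blast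
        then have "x \<otimes> (inv x \<otimes> m \<otimes> x) \<otimes> inv x = x \<otimes> (inv x \<otimes> m)"
          using xc(1) by (simp add: m_assoc)
        also have "\<dots> = m" using xc(1) mc by (simp flip: m_assoc)
        finally show ?thesis by simp
      qed
      ultimately show "m \<in> x <# M #> (inv x)" unfolding l_coset_def r_coset_def by blast
    qed
  qed
  then have "x \<in> normalizer G M"
    using xc Mc by (auto simp: normalizer_def stabilizer_def)
  moreover have nor: "M \<lhd> G\<lparr>carrier := normalizer G M\<rparr>" by (rule subgroup_in_normalizer[OF M(1)])
  moreover from nor have "M \<subseteq> normalizer G M"
    using normal_imp_subgroup subgroup.subset by fastforce
  ultimately have "normalizer G M = carrier G"
    using M(3) normalizer_imp_subgroup[OF Mc] x(2) by blast
  then show ?thesis using nor by simp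
qed

text \<open>Maximality forces \<open>M \<langle>g\<rangle> = G\<close>.\<close>
lemma maximal_normal_factorization:
  assumes "maximal_subgroup M" "M \<lhd> G" "g \<in> carrier G" "g \<notin> M" "x \<in> carrier G"
  obtains m and k :: int where "m \<in> M" "x = m \<otimes> g [^] k"
proof -
  let ?K = "M <#> generate G {g}"
  have M: "subgroup M G" using assms(2) by (rule normal_imp_subgroup)
  have gen: "subgroup (generate G {g}) G" using assms(3) by (intro generate_is_subgroup) auto
  have K: "subgroup ?K G" using mult_norm_subgroup[OF assms(2) gen] .
  have "m \<in> ?K" if "m \<in> M" for m
    using that subgroup.mem_carrier[OF M that] subgroup.one_closed[OF gen]
      set_mult_def[of G M "generate G {g}"] r_one by force
  moreover have "g \<in> ?K"
    using assms(3) subgroup.one_closed[OF M] generate.incl[of g "{g}" G] unfolding set_mult_def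
    by (fastforce intro: bexI[of _ \<one>])
  ultimately have "?K = carrier G" using assms(1,4) K unfolding maximal_subgroup_def by blast
  then show thesis using assms(5) that unfolding set_mult_def generate_pow[OF assms(3)] by blast
qed

text \<open>Here \<open>p\<close> is the order of the coset of \<open>g\<close> in the quotient \<open>G/M\<close>, which is also the index of \<open>M\<close>.
  It is prime because any power of \<open>g\<close> outside \<open>M\<close> again generates \<open>G\<close> together with \<open>M\<close>.\<close>
lemma maximal_normal_index_prime:
  assumes fin: "finite (carrier G)" and max: "maximal_subgroup M" and "M \<lhd> G"
    and g: "g \<in> carrier G" "g \<notin> M"
  obtains p where "Factorial_Ring.prime p" "\<And>k::int. g [^] k \<in> M \<longleftrightarrow> int p dvd k"
proof -
  interpret M: normal M G by fact
  interpret Q: group "G Mod M" by (rule M.factorgroup_is_group)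
  interpret h: group_hom G "G Mod M" "(#>) M"
    using M.r_coset_hom_Mod by unfold_locales
  define p where "p = Q.ord (M #> g)"
  have iff: "g [^] k \<in> M \<longleftrightarrow> int p dvd k" for k :: int
  proof -
    have "g [^] k \<in> M \<longleftrightarrow> M #> (g [^] k) = M"
      using g coset_join1[OF _ _ M.subgroup_axioms] coset_join2[OF _ M.subgroup_axioms] by blast
    also have "\<dots> \<longleftrightarrow> (M #> g) [^]\<^bsub>G Mod M\<^esub> k = \<one>\<^bsub>G Mod M\<^esub>"
      using h.hom_int_pow[OF g(1)] by simp
    also have "\<dots> \<longleftrightarrow> int p dvd k" using Q.int_pow_eq_id g(1) by (simp add: p_def)
    finally show ?thesis .
  qed
  have "g [^] int (ord g) \<in> M" using g by (simp add: int_pow_int)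
  then have "p dvd ord g" by (simp add: iff)
  then have pos: "p > 0" using ord_ge_1[OF fin g(1)] by (auto intro: gr0I)
  have "p \<noteq> 1" using iff[of 1] g by auto
  have "m = 1 \<or> m = p" if "m dvd p" for m
  proof (rule ccontr)
    assume "\<not> (m = 1 \<or> m = p)"
    \<comment> \<open>Expressing \<open>g\<close> modulo \<open>M\<close> as a power of \<open>g\<^sup>m\<close> shows that \<open>m\<close> is a unit modulo \<open>p\<close>.\<close>
    with that pos have "\<not> p dvd m" by (auto dest: dvd_antisym)
    then have "g [^] int m \<notin> M" by (simp add: iff)
    with maximal_normal_factorization[OF max \<open>M \<lhd> G\<close> _ _ g(1), of "g [^] int m"] g
    obtain a k where a: "a \<in> M" "g = a \<otimes> (g [^] int m) [^] (k::int)" by auto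
    have ac: "a \<in> carrier G" using a(1) by auto
    have "g [^] (1::int) = a \<otimes> g [^] (int m * k)" using a(2) g by (simp add: int_pow_pow)
    then have "g [^] (1 - int m * k) = a"
      using g ac by (simp add: int_pow_diff inv_solve_right')
    then have "int p dvd 1 - int m * k" using a(1) iff by metis
    moreover have "int m dvd int p" using that by simp
    ultimately have "int m dvd 1 - int m * k" by (rule dvd_trans[rotated])
    then have "int m dvd 1" by (simp add: dvd_diff_left_iff dvd_diff_right_iff)
    then show False using \<open>\<not> (m = 1 \<or> m = p)\<close> by simp
  qed
  then have "Factorial_Ring.prime p" using pos \<open>p \<noteq> 1\<close> by (auto simp: prime_nat_iff)
  then show thesis using iff that by blast
qed

section \<open>Automorphisms that fix a maximal subgroup pointwise\<close>

lemma int_pow_commutes: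
  fixes k :: int
  assumes "w \<otimes> y = y \<otimes> w" and w: "w \<in> carrier G" and y: "y \<in> carrier G"
  shows "w [^] k \<otimes> y = y \<otimes> w [^] k"
proof -
  have nat: "w [^] n \<otimes> y = y \<otimes> w [^] n" for n :: nat
    using group_commutes_pow assms by blast
  show ?thesis
  proof (cases k rule: int_cases2)
    case (nonneg n)
    then show ?thesis using nat by (simp add: int_pow_int)
  next
    case (nonpos n)
    have "inv (w [^] n) \<otimes> y = inv (w [^] n) \<otimes> (y \<otimes> w [^] n) \<otimes> inv (w [^] n)"
      using w y by (simp add: m_assoc)
    also have "\<dots> = y \<otimes> inv (w [^] n)"
      using w y by (simp flip: nat m_assoc)
    finally show ?thesis using nonpos w by (simp add: int_pow_neg int_pow_int)
  qed
qed

text \<open>Central values let \<open>t x\<close> move past \<open>y\<close>, so that \<open>x \<mapsto> x t(x)\<close> is a homomorphism; the last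
  assumption says that its kernel is trivial.\<close>
lemma central_twist_automorphism:
  assumes fin: "finite (carrier G)" and t: "t \<in> hom G G"
    and central: "\<And>x y. x \<in> carrier G \<Longrightarrow> y \<in> carrier G \<Longrightarrow> t x \<otimes> y = y \<otimes> t x"
    and inj: "\<And>x. x \<in> carrier G \<Longrightarrow> x \<otimes> t x = \<one> \<Longrightarrow> x = \<one>"
  shows "(\<lambda>x\<in>carrier G. x \<otimes> t x) \<in> auto G"
proof -
  have tc: "t x \<in> carrier G" if "x \<in> carrier G" for x using t that by (auto simp: hom_def)
  have hom: "(\<lambda>x. x \<otimes> t x) \<in> hom G G"
  proof (rule homI)
    fix x y assume xy: "x \<in> carrier G" "y \<in> carrier G"
    have "x \<otimes> y \<otimes> t (x \<otimes> y) = x \<otimes> (y \<otimes> t x) \<otimes> t y"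
      using t xy tc by (simp add: hom_mult m_assoc)
    also have "y \<otimes> t x = t x \<otimes> y" using central[OF xy] by simp
    also have "x \<otimes> (t x \<otimes> y) \<otimes> t y = (x \<otimes> t x) \<otimes> (y \<otimes> t y)"
      using xy tc by (simp add: m_assoc)
    finally show "x \<otimes> y \<otimes> t (x \<otimes> y) = (x \<otimes> t x) \<otimes> (y \<otimes> t y)" .
  qed (use tc in auto)
  then interpret f: group_hom G G "\<lambda>x. x \<otimes> t x" by unfold_locales
  have "inj_on (\<lambda>x. x \<otimes> t x) (carrier G)"
    unfolding f.inj_on_one_iff using inj by blast
  moreover from this have "(\<lambda>x. x \<otimes> t x) ` carrier G = carrier G"
    using tc by (intro endo_inj_surj[OF fin]) auto
  ultimately have "bij_betw (\<lambda>x. x \<otimes> t x) (carrier G) (carrier G)"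
    by (simp add: bij_betw_def)
  then have "(\<lambda>x\<in>carrier G. x \<otimes> t x) \<in> Bij (carrier G)"
    by (simp add: Bij_def cong: bij_betw_cong)
  moreover have "(\<lambda>x\<in>carrier G. x \<otimes> t x) \<in> hom G G"
    using hom by (auto simp: hom_def)
  ultimately show ?thesis by (simp add: auto_def)
qed

text \<open>The automorphism multiplies \<open>m g\<^sup>k\<close> by \<open>w\<^sup>k\<close> for \<open>m \<in> M\<close>. It is well defined because \<open>k\<close> is
  determined modulo \<open>p\<close> and \<open>w\<^sup>p = 1\<close>. An element \<open>m g\<^sup>k\<close> of the kernel has \<open>g\<^sup>k w\<^sup>k = m\<^sup>-\<^sup>1 \<in> M\<close>; the
  last assumption then gives \<open>p dvd k\<close>, and nothing was multiplied.\<close>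
lemma twist_by_central_element:
  assumes fin: "finite (carrier G)" and max: "maximal_subgroup M" and "M \<lhd> G"
    and g: "g \<in> carrier G" "g \<notin> M" and p: "\<And>k::int. g [^] k \<in> M \<longleftrightarrow> int p dvd k"
    and w: "w \<in> carrier G" "w \<noteq> \<one>" "w [^] p = \<one>" "\<And>x. x \<in> carrier G \<Longrightarrow> w \<otimes> x = x \<otimes> w"
    and inj: "\<And>k::int. g [^] k \<otimes> w [^] k \<in> M \<Longrightarrow> g [^] k \<in> M"
  shows "\<exists>\<phi>\<in>auto G. (\<forall>x\<in>M. \<phi> x = x) \<and> (\<exists>x\<in>carrier G. \<phi> x \<noteq> x)"
proof -
  interpret M: normal M G by fact
  have wk: "w [^] k = \<one>" if "int p dvd k" for k :: int
    using w(1,3) that by (auto simp: int_pow_int simp flip: int_pow_pow elim!: dvdE)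
  \<comment> \<open>The exponent \<open>k\<close> with \<open>x \<in> M g\<^sup>k\<close> is chosen arbitrarily; the power of \<open>w\<close> does not depend on it.\<close>
  define t where "t x = w [^] (SOME k::int. \<exists>m\<in>M. x = m \<otimes> g [^] k)" for x
  have t: "t (m \<otimes> g [^] k) = w [^] k" if m: "m \<in> M" for m and k :: int
  proof -
    let ?x = "m \<otimes> g [^] k"
    define l where "l = (SOME l::int. \<exists>m\<in>M. ?x = m \<otimes> g [^] l)"
    have "\<exists>m\<in>M. ?x = m \<otimes> g [^] l" unfolding l_def by (rule someI[of _ k]) (use m in blast)
    then obtain n where n: "n \<in> M" "m \<otimes> g [^] k = n \<otimes> g [^] l" by blast
    have c: "m \<in> carrier G" "n \<in> carrier G" using m n by auto
    have "g [^] (k - l) = inv m \<otimes> (m \<otimes> g [^] k) \<otimes> inv (g [^] l)"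
      using c g by (simp add: int_pow_diff flip: m_assoc)
    also have "\<dots> = inv m \<otimes> n" unfolding n(2) using c g by (simp add: m_assoc)
    finally have "g [^] (k - l) \<in> M" using m n by simp
    then have "w [^] (k - l) = \<one>" using p wk by blast
    then have "w [^] k = w [^] l" using w(1) by (simp add: int_pow_diff) (metis inv_equality inv_inv int_pow_closed inv_closed)
    then show ?thesis by (simp add: t_def l_def)
  qed
  have fact: "\<exists>m\<in>M. \<exists>k::int. x = m \<otimes> g [^] k" if "x \<in> carrier G" for x
    using maximal_normal_factorization[OF max \<open>M \<lhd> G\<close> g that] by blast
  have hom: "t \<in> hom G G"
  proof (rule homI)
    fix x y assume xy: "x \<in> carrier G" "y \<in> carrier G"
    obtain m k where m: "m \<in> M" "x = m \<otimes> g [^] (k::int)" using fact[OF xy(1)] by blast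
    obtain n l where n: "n \<in> M" "y = n \<otimes> g [^] (l::int)" using fact[OF xy(2)] by blast
    let ?n = "g [^] k \<otimes> n \<otimes> inv (g [^] k)"
    have c: "m \<in> carrier G" "n \<in> carrier G" using m n by auto
    have "?n \<in> M" using n g by (simp add: M.inv_op_closed2)
    moreover have "x \<otimes> y = (m \<otimes> ?n) \<otimes> g [^] (k + l)"
      using m(2) n(2) c g by (simp add: int_pow_mult m_assoc) (simp flip: m_assoc)
    ultimately show "t (x \<otimes> y) = t x \<otimes> t y"
      using m n w(1) by (simp add: t int_pow_mult)
  qed (simp add: t_def w)
  have central: "t x \<otimes> y = y \<otimes> t x" if "y \<in> carrier G" for x y
    using that w by (simp add: t_def int_pow_commutes)
  have "x = \<one>" if x: "x \<in> carrier G" "x \<otimes> t x = \<one>" for x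
  proof -
    obtain m k where m: "m \<in> M" "x = m \<otimes> g [^] (k::int)" using fact[OF x(1)] by blast
    have c: "m \<in> carrier G" using m by auto
    have "m \<otimes> (g [^] k \<otimes> w [^] k) = \<one>" using x(2) m c g w by (simp add: t m_assoc)
    then have "g [^] k \<otimes> w [^] k = inv m"
      using c g w by (metis int_pow_closed inv_equality inv_inv inv_closed m_closed)
    then have "g [^] k \<in> M" using m inj by simp
    then have "t x = \<one>" using m p wk by (simp add: t)
    then show ?thesis using x by simp
  qed
  then have "(\<lambda>x\<in>carrier G. x \<otimes> t x) \<in> auto G" (is "?\<phi> \<in> _")
    using central_twist_automorphism[OF fin hom central] by blast
  moreover have "?\<phi> x = x" if "x \<in> M" for x
    using t[OF that, of 0] that by simp
  moreover have "?\<phi> g \<noteq> g"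
    using t[OF M.one_closed, of 1] g w by simp
  ultimately show ?thesis using g(1) by blast
qed

text \<open>If \<open>z \<in> M\<close>, twist by \<open>w = z\<close>. Otherwise \<open>z\<close> generates a complement of \<open>M\<close>, and the twist along
  \<open>g = z\<close> by \<open>w = z\<^sup>-\<^sup>2\<close> is the automorphism \<open>m z\<^sup>k \<mapsto> m z\<^sup>-\<^sup>k\<close>, which is nontrivial as \<open>p\<close> is odd.\<close>
lemma automorphism_fixing_maximal_subgroup:
  assumes fin: "finite (carrier G)" and max: "maximal_subgroup M" and "M \<lhd> G"
    and p: "Factorial_Ring.prime p" and g: "g \<in> carrier G" "g \<notin> M"
    and index: "\<And>k::int. g [^] k \<in> M \<longleftrightarrow> int p dvd k"
    and z: "z \<in> carrier G" "z \<noteq> \<one>" "z [^] p = \<one>" "\<And>x. x \<in> carrier G \<Longrightarrow> z \<otimes> x = x \<otimes> z"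
    and "z \<in> M \<or> p \<noteq> 2"
  shows "\<exists>\<phi>\<in>auto G. (\<forall>x\<in>M. \<phi> x = x) \<and> (\<exists>x\<in>carrier G. \<phi> x \<noteq> x)"
proof (cases "z \<in> M")
  case True
  have M: "subgroup M G" using \<open>M \<lhd> G\<close> by (rule normal_imp_subgroup)
  have "g [^] k \<in> M" if "g [^] k \<otimes> z [^] k \<in> M" for k :: int
  proof -
    have "z [^] k \<in> M" using subgroup_int_pow_closed[OF M True] .
    then have "g [^] k \<otimes> z [^] k \<otimes> inv (z [^] k) \<in> M"
      using that M by (simp add: subgroup.m_closed subgroup.m_inv_closed)
    then show ?thesis using g z by (simp add: m_assoc)
  qed
  then show ?thesis
    using twist_by_central_element[OF fin max \<open>M \<lhd> G\<close> g index z] by blast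
next
  case False
  then have "p \<noteq> 2" using assms by blast
  \<comment> \<open>The element \<open>z\<close> now takes the place of \<open>g\<close>; its order modulo \<open>M\<close> divides \<open>p\<close>, hence equals \<open>p\<close>.\<close>
  obtain q where q: "Factorial_Ring.prime q" "\<And>k::int. z [^] k \<in> M \<longleftrightarrow> int q dvd k"
    using maximal_normal_index_prime[OF fin max \<open>M \<lhd> G\<close> z(1) False] by blast
  have M: "subgroup M G" using \<open>M \<lhd> G\<close> by (rule normal_imp_subgroup)
  have "z [^] int p \<in> M" using z(3) subgroup.one_closed[OF M] by (simp add: int_pow_int)
  then have "q dvd p" by (simp add: q(2))
  then have "q = p" using p q(1) primes_dvd_imp_eq by blast
  note zM = q(2)[unfolded \<open>q = p\<close>]
  define w where "w = z [^] (-2 :: int)"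
  have w: "w \<in> carrier G" using z(1) by (simp add: w_def)
  have "\<not> p dvd 2" using \<open>p \<noteq> 2\<close> p primes_dvd_imp_eq two_is_prime_nat by blast
  then have "\<not> int p dvd -2" by (metis dvd_minus_iff int_dvd_int_iff of_nat_numeral)
  then have "w \<notin> M" unfolding w_def zM .
  then have w1: "w \<noteq> \<one>" using subgroup.one_closed[OF M] by blast
  have "w [^] int p = (z [^] int p) [^] (-2 :: int)"
    using z(1) by (simp add: w_def int_pow_pow mult.commute)
  then have wp: "w [^] p = \<one>" using z(3) by (simp add: int_pow_int)
  have wc: "w \<otimes> x = x \<otimes> w" if "x \<in> carrier G" for x
    unfolding w_def using z that by (intro int_pow_commutes) auto
  have "z [^] k \<in> M" if "z [^] k \<otimes> w [^] k \<in> M" for k :: int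
  proof -
    have "z [^] k \<otimes> w [^] k = z [^] (k + (-2) * k)"
      unfolding w_def int_pow_pow[OF z(1)] by (rule int_pow_mult[OF z(1), symmetric])
    also have "k + (-2) * k = - k" by simp
    finally have "int p dvd - k" using that zM[of "-k"] by simp
    then show ?thesis by (simp add: zM)
  qed
  then show ?thesis
    using twist_by_central_element[OF fin max \<open>M \<lhd> G\<close> z(1) False zM w w1 wp wc] by blast
qed

section \<open>Comparing determining and generating sets\<close>

text \<open>Either \<open>D\<close> generates, or every maximal subgroup above \<open>D\<close> has index 2 and contains no central
  involution. In the second case, multiplying one element of \<open>D\<close> by a central involution makes \<open>D\<close>
  generate. The bound on the order excludes the group with two elements, for which the empty set is
  determining but not generating.\<close>
lemma determining_set_imp_generating_set:
  assumes fin: "finite (carrier G)" and nil: "lower_central_series G n = {\<one>}"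
    and order: "order G \<ge> 3" and det: "determining_set G D"
  shows "\<exists>S. generating_set G S \<and> finite S \<and> card S \<le> card D"
proof (cases "generate G D = carrier G")
  case True
  have "D \<subseteq> carrier G" using det by (simp add: determining_set_def)
  with True show ?thesis using fin by (auto simp: generating_set_def intro: finite_subset)
next
  case False
  have D: "D \<subseteq> carrier G" "finite D"
    using det fin by (auto simp: determining_set_def intro: finite_subset)
  have H: "subgroup (generate G D) G" using D(1) by (rule generate_is_subgroup)
  \<comment> \<open>Otherwise a nontrivial automorphism would fix \<open>M\<close>, and with it \<open>D\<close>, pointwise.\<close>
  have exceptional: "p = 2 \<and> z \<notin> M"
    if exc: "maximal_subgroup M" "D \<subseteq> M" "Factorial_Ring.prime p" "g \<in> carrier G" "g \<notin> M"
      "\<And>k::int. g [^] k \<in> M \<longleftrightarrow> int p dvd k"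
      "z \<in> carrier G" "z \<noteq> \<one>" "z [^] p = \<one>" "\<forall>x\<in>carrier G. z \<otimes> x = x \<otimes> z"
    for M p g z
  proof (rule ccontr)
    assume "\<not> (p = 2 \<and> z \<notin> M)"
    then obtain \<phi> where "\<phi> \<in> auto G" "\<forall>x\<in>M. \<phi> x = x" "\<exists>x\<in>carrier G. \<phi> x \<noteq> x"
      using automorphism_fixing_maximal_subgroup[OF fin exc(1)
          nilpotent_maximal_subgroup_normal[OF nil exc(1)] exc(3-9)] exc(10) by blast
    then show False using det \<open>D \<subseteq> M\<close> unfolding determining_set_def by blast
  qed
  have index: "\<exists>p g z. Factorial_Ring.prime p \<and> g \<in> carrier G \<and> g \<notin> M \<and>
      (\<forall>k::int. g [^] k \<in> M \<longleftrightarrow> int p dvd k) \<and>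
      z \<in> carrier G \<and> z \<noteq> \<one> \<and> z [^] p = \<one> \<and> (\<forall>x\<in>carrier G. z \<otimes> x = x \<otimes> z)"
    if M: "maximal_subgroup M" for M
  proof -
    note nor = nilpotent_maximal_subgroup_normal[OF nil M]
    have "subgroup M G" using M by (simp add: maximal_subgroup_def)
    then have "M \<subseteq> carrier G" by (rule subgroup.subset)
    then obtain g where g: "g \<in> carrier G" "g \<notin> M" using M by (auto simp: maximal_subgroup_def)
    obtain p where p: "Factorial_Ring.prime p" "\<And>k::int. g [^] k \<in> M \<longleftrightarrow> int p dvd k"
      using maximal_normal_index_prime[OF fin M nor g] by blast
    have "g [^] int (order G) \<in> M"
      using g pow_order_eq_1 subgroup.one_closed[OF \<open>subgroup M G\<close>] by (simp add: int_pow_int)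
    then have "p dvd card (carrier G)" using p(2) by (simp add: order_def)
    then show ?thesis
      using central_element_of_prime_order[OF fin nil normal_self p(1)] g p by blast
  qed
  obtain M where M: "maximal_subgroup M" "generate G D \<subseteq> M"
    using proper_subgroup_in_maximal[OF fin H False] by blast
  have DM: "D \<subseteq> M" using M(2) generate.incl by fast
  obtain p g z where g: "Factorial_Ring.prime p" "g \<in> carrier G" "g \<notin> M"
      "\<And>k::int. g [^] k \<in> M \<longleftrightarrow> int p dvd k"
    and z: "z \<in> carrier G" "z \<noteq> \<one>" "z [^] p = \<one>" "\<forall>x\<in>carrier G. z \<otimes> x = x \<otimes> z"
    using index[OF M(1)] by auto
  have "p = 2" using exceptional[OF M(1) DM g z] by blast
  \<comment> \<open>A maximal subgroup above \<open>D \<union> {z}\<close> contains the central involution \<open>z\<close>, so it cannot be exceptional.\<close>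
  have gen: "generate G (insert z D) = carrier G"
  proof (rule ccontr)
    assume "generate G (insert z D) \<noteq> carrier G"
    moreover have "subgroup (generate G (insert z D)) G"
      using D(1) z(1) by (intro generate_is_subgroup) auto
    ultimately obtain M' where M': "maximal_subgroup M'" "generate G (insert z D) \<subseteq> M'"
      using proper_subgroup_in_maximal[OF fin] by blast
    then have DM': "D \<subseteq> M'" and zM': "z \<in> M'"
      using generate.incl[of _ "insert z D" G] by blast+
    obtain q h y where h: "Factorial_Ring.prime q" "h \<in> carrier G" "h \<notin> M'"
        "\<And>k::int. h [^] k \<in> M' \<longleftrightarrow> int q dvd k"
      and y: "y \<in> carrier G" "y \<noteq> \<one>" "y [^] q = \<one>" "\<forall>x\<in>carrier G. y \<otimes> x = x \<otimes> y"
      using index[OF M'(1)] by auto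
    have "q = 2" using exceptional[OF M'(1) DM' h y] by blast
    then show False
      using exceptional[OF M'(1) DM' h z(1,2) _ z(4)] z(3) zM' \<open>p = 2\<close> by blast
  qed
  have "D \<noteq> {}"
  proof
    assume "D = {}"
    then have "card (generate G {z}) = order G" using gen by (simp add: order_def)
    then have "ord z = order G" using generate_pow_card[OF z(1)] by simp
    moreover have "ord z dvd 2" using z(1,3) \<open>p = 2\<close> pow_eq_id by blast
    ultimately show False using order by (auto dest: dvd_imp_le)
  qed
  then obtain d where d: "d \<in> D" by blast
  have dc: "d \<in> carrier G" "d \<in> M" using d D DM by auto
  have Msub: "subgroup M G" using M(1) by (simp add: maximal_subgroup_def)
  \<comment> \<open>If the order of \<open>M\<close> were even, then \<open>M\<close> would contain a central involution.\<close>
  have odd: "odd (card M)"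
  proof
    assume "even (card M)"
    then obtain y where "y \<in> M" "y \<noteq> \<one>" "y [^] p = \<one>" "\<forall>x\<in>carrier G. y \<otimes> x = x \<otimes> y"
      using central_element_of_prime_order[OF fin nil nilpotent_maximal_subgroup_normal[OF nil M(1)] g(1)]
        \<open>p = 2\<close> by blast
    then show False
      using exceptional[OF M(1) DM g subgroup.mem_carrier[OF Msub]] by blast
  qed
  let ?S = "insert (d \<otimes> z) (D - {d})"
  have S: "?S \<subseteq> carrier G" using D dc z by auto
  note gS = generate_is_subgroup[OF S]
  have dz: "d \<otimes> z \<in> generate G ?S" by (intro generate.incl) simp
  \<comment> \<open>The odd power \<open>(d z)\<^bsup>|M|\<^esup>\<close> kills \<open>d\<close> and keeps the involution \<open>z\<close>.\<close>
  have "d [^] card M = \<one>"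
    using group.pow_order_eq_1[OF subgroup_imp_group[OF Msub], of d] dc(2)
    by (simp add: order_def flip: nat_pow_consistent)
  moreover have "z [^] card M = z"
  proof -
    obtain k where "card M = 2 * k + 1" using odd by (rule oddE)
    then have "z [^] card M = (z [^] (2::nat)) [^] k \<otimes> z"
      using z(1) by (simp add: nat_pow_pow)
    then show ?thesis using z(1,3) \<open>p = 2\<close> by simp
  qed
  ultimately have "(d \<otimes> z) [^] card M = z"
    using z dc pow_mult_distrib[of d z "card M"] by simp
  then have zS: "z \<in> generate G ?S"
    using subgroup_int_pow_closed[OF gS dz, of "int (card M)"] by (simp add: int_pow_int)
  have "d \<otimes> z \<otimes> inv z \<in> generate G ?S"
    using subgroup.m_closed[OF gS dz subgroup.m_inv_closed[OF gS zS]] .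
  then have "d \<in> generate G ?S" using dc z(1) by (simp add: m_assoc)
  then have "insert z D \<subseteq> generate G ?S" using zS generate.incl[of _ ?S G] by blast
  then have "carrier G \<subseteq> generate G ?S" using generate_subgroup_incl[OF _ gS] gen by blast
  then have "generating_set G ?S"
    using S generate_incl[OF S] by (auto simp: generating_set_def)
  moreover have "card ?S \<le> card D"
    using d D(2) by (metis card_Suc_Diff1 card_insert_le_m1 card_insert_if finite_Diff le_SucI order_refl)
  ultimately show ?thesis using D(2) by blast
qed

lemma generating_set_imp_determining_set:
  assumes "generating_set G S"
  shows "determining_set G S"
  unfolding determining_set_def
proof (intro conjI ballI impI)
  show S: "S \<subseteq> carrier G" using assms by (simp add: generating_set_def)
  fix \<phi> x assume \<phi>: "\<phi> \<in> auto G" and fixes_S: "\<forall>x\<in>S. \<phi> x = x" and "x \<in> carrier G"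
  then have "x \<in> generate G S" using assms by (simp add: generating_set_def)
  interpret \<phi>: group_hom G G \<phi> using \<phi> by unfold_locales (simp add: auto_def)
  from \<open>x \<in> generate G S\<close> show "\<phi> x = x"
  proof (induction rule: generate.induct)
    case (eng h1 h2)
    then show ?case using generate_in_carrier[OF S] by simp
  qed (use fixes_S S in auto)
qed

end

theorem theorem5p7:
  fixes G :: "('a, 'b) monoid_scheme"
  assumes "nilpotent_group G"
    and "finite (carrier G)"
    and "order G \<ge> 3"
  shows "DEG_group G"
proof -
  interpret group G using assms(1) by (simp add: nilpotent_group_def)
  obtain n where nil: "lower_central_series G n = {\<one>\<^bsub>G\<^esub>}"
    using assms(1) by (auto simp: nilpotent_group_def)
  have "determining_number G \<le> generating_number G"
    unfolding determining_number_def generating_number_def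
    by (rule INF_superset_mono) (auto intro: generating_set_imp_determining_set)
  moreover have "generating_number G \<le> determining_number G"
    unfolding determining_number_def
  proof (rule INF_greatest)
    fix D assume "D \<in> {D. determining_set G D \<and> finite D}"
    then obtain S where "generating_set G S" "finite S" "card S \<le> card D"
      using determining_set_imp_generating_set[OF assms(2) nil assms(3)] by blast
    then show "generating_number G \<le> enat (card D)"
      unfolding generating_number_def by (intro INF_lower2[of S]) auto
  qed
  ultimately show ?thesis unfolding DEG_group_def using is_group by auto
qed

end
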